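(* Trees on $n$ vertices with distinct chromatic symmetric functions form an antichain in $\mathcal{E}_n$; that is, if $T_1$ and $T_2$ are trees on $n$ vertices with $X_{T_1}\neq X_{T_2}$, then neither $T_1\geq_e T_2$ nor $T_2\geq_e T_1$.
   Context: All graphs are finite and simple. The chromatic symmetric function of a graph $G$ with vertices $v_1,\dots,v_n$ is $X_G=\sum_{\kappa}x_{\kappa(v_1)}\cdots x_{\kappa(v_n)}$, summed over all proper colorings $\kappa:V(G)\to\{1,2,3,\dots\}$; it is a homogeneous symmetric function of degree $n$ over $\mathbb{Q}$. Let $e_\lambda=e_{\lambda_1}e_{\lambda_2}\cdots$ be the elementary symmetric functions; $[e_\lambda]F$ denotes the coefficient of $e_\lambda$ in $F$ expanded in this basis, and $F$ is $e$-positive if $[e_\lambda]F\ge 0$ for all $\lambda$. For connected graphs $G,H$ on $n$ vertices (for which $[e_{(n)}]X_G$ and $[e_{(n)}]X_H$ are positive), set $$X_e(G,H)=X_G-\frac{[e_{(n)}]X_G}{[e_{(n)}]X_H}X_H.$$ $\mathcal{E}_n$ is the poset whose elements are the equivalence classes of connected graphs on $n$ vertices under $G\sim H\iff X_G=X_H$, ordered by $G\geq_e H$ if and only if $X_e(G,H)$ is $e$-positive. *)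

theory Defs
  imports "HOL-Library.Multiset" "HOL-Library.FuncSet" "Graph_Theory.Graph_Theory"
begin

text \<open>
  Formal power series in commuting variables $x_0, x_1, x_2, \dots$ A monomial is the finite
  multiset of the indices of its variables. Colours and variables are numbered from 0 instead of 1.
\<close>

typedef 'a mseries = "UNIV :: (nat multiset \<Rightarrow> 'a) set"
  morphisms mcoeff Abs_mseries ..

setup_lifting type_definition_mseries

lemma mseries_eqI: "(\<And>m. mcoeff f m = mcoeff g m) \<Longrightarrow> f = g"
  by transfer auto

lemma finite_mset_splits: "finite {(a, b). a + b = (m :: 'b multiset)}"
proof (induction m)
  case (add x m)
  let ?S = "{(a, b). a + b = m}"
  have "{(a, b). a + b = add_mset x m} \<subseteq>
      (\<lambda>(a, b). (add_mset x a, b)) ` ?S \<union> (\<lambda>(a, b). (a, add_mset x b)) ` ?S" (is "?L \<subseteq> ?R")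
  proof
    fix p assume "p \<in> ?L"
    then obtain a b where p: "p = (a, b)" and ab: "a + b = add_mset x m" by auto
    have "x \<in># a + b" using ab by simp
    then consider "x \<in># a" | "x \<in># b" by auto
    then show "p \<in> ?R"
    proof cases
      case 1
      then obtain a' where a': "a = add_mset x a'" by (blast dest: multi_member_split)
      with ab have "a' + b = m" by simp
      with p a' show ?thesis by force
    next
      case 2
      then obtain b' where b': "b = add_mset x b'" by (blast dest: multi_member_split)
      with ab have "a + b' = m" by simp
      with p b' show ?thesis by force
    qed
  qed
  then show ?case using add.IH by (auto intro: finite_subset)
qed (auto intro: finite_subset[of _ "{({#}, {#})}"])

instantiation mseries :: (comm_ring_1) comm_ring_1
begin

lift_definition zero_mseries :: "'a mseries" is "\<lambda>_. 0" .

lift_definition one_mseries :: "'a mseries" is "\<lambda>m. if m = {#} then 1 else 0" .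

lift_definition plus_mseries :: "'a mseries \<Rightarrow> 'a mseries \<Rightarrow> 'a mseries"
  is "\<lambda>f g m. f m + g m" .

lift_definition uminus_mseries :: "'a mseries \<Rightarrow> 'a mseries" is "\<lambda>f m. - f m" .

lift_definition minus_mseries :: "'a mseries \<Rightarrow> 'a mseries \<Rightarrow> 'a mseries"
  is "\<lambda>f g m. f m - g m" .

lift_definition times_mseries :: "'a mseries \<Rightarrow> 'a mseries \<Rightarrow> 'a mseries"
  is "\<lambda>f g m. \<Sum>(a, b) \<in> {(a, b). a + b = m}. f a * g b" .

instance
proof
  fix f g h :: "'a mseries"
  show "f + g + h = f + (g + h)" "f + g = g + f" "0 + f = f" "- f + f = 0" "f - g = f + - g"
    by (transfer; simp add: fun_eq_iff algebra_simps)+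
  show "(0 :: 'a mseries) \<noteq> 1"
    by transfer (auto simp: fun_eq_iff)
  show "f * g = g * f"
  proof (transfer, rule ext)
    fix f g :: "nat multiset \<Rightarrow> 'a" and m
    show "(\<Sum>(a, b)\<in>{(a, b). a + b = m}. f a * g b) = (\<Sum>(a, b)\<in>{(a, b). a + b = m}. g a * f b)"
      by (rule sum.reindex_bij_witness[of _ prod.swap prod.swap]) (auto simp: ac_simps)
  qed
  show "1 * f = f"
  proof (transfer, rule ext)
    fix f :: "nat multiset \<Rightarrow> 'a" and m
    have "(\<Sum>(a, b)\<in>{(a, b). a + b = m}. (if a = {#} then 1 else 0) * f b) =
        (\<Sum>(a, b)\<in>{({#} :: nat multiset, m)}. (if a = {#} then 1 else 0) * f b)"
      by (rule sum.mono_neutral_right) (auto intro: finite_mset_splits split: if_splits)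
    then show "(\<Sum>(a, b)\<in>{(a, b). a + b = m}. (if a = {#} then 1 else 0) * f b) = f m"
      by simp
  qed
  show "(f + g) * h = f * h + g * h"
    by transfer (simp add: fun_eq_iff distrib_right case_prod_beta sum.distrib)
  show "f * g * h = f * (g * h)"
  proof (transfer, rule ext)
    fix f g h :: "nat multiset \<Rightarrow> 'a" and m
    let ?S = "\<lambda>m. {(a, b). a + b = (m :: nat multiset)}"
    have "(\<Sum>(c, d)\<in>?S m. (\<Sum>(a, b)\<in>?S c. f a * g b) * h d) =
        (\<Sum>p\<in>?S m. \<Sum>q\<in>?S (fst p). f (fst q) * g (snd q) * h (snd p))"
      by (simp add: case_prod_beta sum_distrib_right)
    also have "\<dots> = (\<Sum>(p, q)\<in>Sigma (?S m) (\<lambda>p. ?S (fst p)). f (fst q) * g (snd q) * h (snd p))"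
      by (rule sum.Sigma) (auto intro: finite_mset_splits)
    also have "\<dots> = (\<Sum>(p, q)\<in>Sigma (?S m) (\<lambda>p. ?S (snd p)). f (fst p) * g (fst q) * h (snd q))"
      by (rule sum.reindex_bij_witness[of _
            "\<lambda>((a, _), (b, d)). ((a + b, d), (a, b))" "\<lambda>((_, d), (a, b)). ((a, b + d), (b, d))"])
         (auto simp: ac_simps)
    also have "\<dots> = (\<Sum>p\<in>?S m. \<Sum>q\<in>?S (snd p). f (fst p) * g (fst q) * h (snd q))"
      by (rule sum.Sigma[symmetric]) (auto intro: finite_mset_splits)
    also have "\<dots> = (\<Sum>(a, c)\<in>?S m. f a * (\<Sum>(b, d)\<in>?S c. g b * h d))"
      by (simp add: case_prod_beta sum_distrib_left mult.assoc)
    finally show "(\<Sum>(c, d)\<in>?S m. (\<Sum>(a, b)\<in>?S c. f a * g b) * h d) =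
        (\<Sum>(a, c)\<in>?S m. f a * (\<Sum>(b, d)\<in>?S c. g b * h d))" .
  qed
qed

end

lift_definition mscale :: "'a::comm_ring_1 \<Rightarrow> 'a mseries \<Rightarrow> 'a mseries"
  is "\<lambda>c f m. c * f m" .

global_interpretation mseries: vector_space "mscale :: rat \<Rightarrow> rat mseries \<Rightarrow> rat mseries"
  by standard (transfer; simp add: fun_eq_iff algebra_simps)+


lift_definition elem_sym :: "nat \<Rightarrow> rat mseries"
  is "\<lambda>k m. if \<exists>A. finite A \<and> card A = k \<and> m = mset_set A then 1 else 0" .

text \<open>An integer partition is the multiset of its (positive) parts.\<close>

definition partitions :: "nat multiset set" where
  "partitions = {\<mu>. 0 \<notin># \<mu>}"

definition e_fun :: "nat multiset \<Rightarrow> rat mseries" where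
  "e_fun \<mu> = (\<Prod>k\<in>#\<mu>. elem_sym k)"

definition e_basis :: "rat mseries set" where
  "e_basis = e_fun ` partitions"

text \<open>
  The coefficient $[e_\mu]F$. It is meaningful for symmetric \<open>F\<close> of bounded degree, which is
  what the span of the $e_\mu$ consists of; outside that span the value is 0.
\<close>

definition e_coeff :: "nat multiset \<Rightarrow> rat mseries \<Rightarrow> rat" where
  "e_coeff \<mu> F = mseries.representation e_basis F (e_fun \<mu>)"

definition e_positive :: "rat mseries \<Rightarrow> bool" where
  "e_positive F \<longleftrightarrow> (\<forall>\<mu>\<in>partitions. e_coeff \<mu> F \<ge> 0)"


text \<open>
  A finite simple graph is a \<^locale>\<open>pair_graph\<close>: finite vertex set, irreflexive symmetric set of
  vertex pairs, so that an edge $uv$ is the pair of opposite arcs $(u,v)$, $(v,u)$. Colourings are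
  taken extensional, so that each is counted once.
\<close>

definition proper_colorings :: "'a pair_pre_digraph \<Rightarrow> ('a \<Rightarrow> nat) set" where
  "proper_colorings G = {\<kappa> \<in> extensional (pverts G). \<forall>(u, v) \<in> parcs G. \<kappa> u \<noteq> \<kappa> v}"

text \<open>
  The coefficient of a monomial in $\sum_\kappa x_{\kappa(v_1)} \cdots x_{\kappa(v_n)}$ is the
  number, always finite, of proper colourings that produce it.
\<close>

lift_definition chrom_sym :: "'a pair_pre_digraph \<Rightarrow> rat mseries"
  is "\<lambda>G m. of_nat (card {\<kappa> \<in> proper_colorings G. image_mset \<kappa> (mset_set (pverts G)) = m})" .

lemma finite_colorings_with_monomial:
  assumes "finite (pverts G)"
  shows "finite {\<kappa> \<in> proper_colorings G. image_mset \<kappa> (mset_set (pverts G)) = m}"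
proof (rule finite_subset)
  show "finite (pverts G \<rightarrow>\<^sub>E set_mset m)"
    using assms by (intro finite_PiE) auto
  show "{\<kappa> \<in> proper_colorings G. image_mset \<kappa> (mset_set (pverts G)) = m}
      \<subseteq> pverts G \<rightarrow>\<^sub>E set_mset m"
    using assms by (auto simp: proper_colorings_def PiE_def)
qed

definition connected_graphs :: "nat \<Rightarrow> 'a pair_pre_digraph set" where
  "connected_graphs n =
    {G. pair_graph G \<and> Digraph_Component.connected (with_proj G) \<and> card (pverts G) = n}"

text \<open>
  In a symmetric digraph every edge $uv$ yields the closed walk $u, v, u$, which the library counts
  as a cycle; the cycles of the undirected graph are those of length at least 3. (For the same
  reason the library predicates \<open>forest\<close> and \<open>tree\<close> do not apply here.)
\<close>

definition tree_graphs :: "nat \<Rightarrow> 'a pair_pre_digraph set" where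
  "tree_graphs n =
    {G \<in> connected_graphs n. \<not> (\<exists>p. pre_digraph.cycle (with_proj G) p \<and> length p \<ge> 3)}"


definition X_e :: "'a pair_pre_digraph \<Rightarrow> 'b pair_pre_digraph \<Rightarrow> rat mseries" where
  "X_e G H = chrom_sym G -
     mscale (e_coeff {#card (pverts G)#} (chrom_sym G) / e_coeff {#card (pverts H)#} (chrom_sym H))
       (chrom_sym H)"

definition geq_e :: "'a pair_pre_digraph \<Rightarrow> 'b pair_pre_digraph \<Rightarrow> bool" (infix \<open>\<ge>\<^sub>e\<close> 50) where
  "G \<ge>\<^sub>e H \<longleftrightarrow> e_positive (X_e G H)"

definition csf_rel :: "nat \<Rightarrow> 'a pair_pre_digraph rel" where
  "csf_rel n =
    {(G, H). G \<in> connected_graphs n \<and> H \<in> connected_graphs n \<and> chrom_sym G = chrom_sym H}"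

lemma equiv_csf_rel: "equiv (connected_graphs n) (csf_rel n)"
  by (rule equivI) (auto simp: csf_rel_def refl_on_def sym_def trans_def)

text \<open>The underlying set of the poset $\mathcal{E}_n$, and its order relation.\<close>

definition csf_classes :: "nat \<Rightarrow> 'a pair_pre_digraph set set" where
  "csf_classes n = connected_graphs n // csf_rel n"

definition class_geq_e :: "'a pair_pre_digraph set \<Rightarrow> 'a pair_pre_digraph set \<Rightarrow> bool" where
  "class_geq_e A B \<longleftrightarrow> (\<exists>G\<in>A. \<exists>H\<in>B. G \<ge>\<^sub>e H)"

lemma class_geq_e_iff:
  assumes "G \<in> connected_graphs n" "H \<in> connected_graphs n"
  shows "class_geq_e (csf_rel n `` {G}) (csf_rel n `` {H}) \<longleftrightarrow> G \<ge>\<^sub>e H"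
proof -
  have "G' \<ge>\<^sub>e H' \<longleftrightarrow> G \<ge>\<^sub>e H" if "(G, G') \<in> csf_rel n" "(H, H') \<in> csf_rel n" for G' H'
    using that by (simp add: csf_rel_def connected_graphs_def geq_e_def X_e_def)
  moreover have "(G, G) \<in> csf_rel n" "(H, H) \<in> csf_rel n"
    using assms by (auto simp: csf_rel_def)
  ultimately show ?thesis
    unfolding class_geq_e_def by blast
qed

definition antichain_in_csf_poset :: "nat \<Rightarrow> 'a pair_pre_digraph set set \<Rightarrow> bool" where
  "antichain_in_csf_poset n S \<longleftrightarrow> S \<subseteq> csf_classes n \<and> pairwise (\<lambda>A B. \<not> class_geq_e A B) S"

definition tree_classes :: "nat \<Rightarrow> 'a pair_pre_digraph set set" where
  "tree_classes n = {csf_rel n `` {T} | T. T \<in> tree_graphs n}"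

end

theory Submission
  imports Defs "HOL-Library.Multiset_Order" "HOL-Combinatorics.Transposition"
    "HOL-Computational_Algebra.Polynomial" "HOL-Computational_Algebra.Formal_Power_Series"
begin

text \<open>
  Setting $q$ of the variables to 1 and the others to 0 turns
  $X_T = \sum_{\mu \vdash n} c_\mu e_\mu$ into the chromatic polynomial, so
  $\sum_\mu c_\mu \prod_i \binom{q}{\mu_i} = q (q-1)^{n-1}$ for every tree $T$ on $n$ vertices,
  an identity of polynomials in $q$. Only $\mu = (n)$ contributes to its linear coefficient, which
  determines $c_{(n)}$; at $q = -1$ it gives $\sum_\mu c_\mu = 2^{n-1}$. Hence
  $X_e(T_1, T_2) = X_{T_1} - X_{T_2}$, and its coefficients in the basis of the $e_\mu$ sum to 0.
  If none of them is negative, all of them vanish.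
\<close>

subsection \<open>Elementary symmetric functions as a basis\<close>

text \<open>The coefficients are read off by \<open>representation\<close>, which is informative
  only for members of the span of an independent set. So it must be proved that the
  \<open>e_fun \<mu>\<close> are independent and that their span contains every symmetric
  homogeneous series. Both follow from unitriangularity: in a well-founded linear order of monomials
  compatible with multiplication, each \<open>e_fun \<mu>\<close> has a least monomial, with
  coefficient 1, and different partitions have different ones.

  The linear coefficient singles out (n) because binom(q,k) vanishes at q = 0 for k > 0, so that a
  product of two or more of them is divisible by q^2. The value at q = -1 treats all partitions of n
  alike because binom(-1,k) = (-1)^k, which makes each product (-1)^n. Neither evaluation counts
  colourings: only natural q do, and agreement at all of them gives the polynomial identity.\<close>

definition symmetric_series :: "rat mseries \<Rightarrow> bool" where
  "symmetric_series F \<longleftrightarrow> (\<forall>\<pi> m. bij \<pi> \<longrightarrow> mcoeff F (image_mset \<pi> m) = mcoeff F m)"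

definition homogeneous :: "nat \<Rightarrow> rat mseries \<Rightarrow> bool" where
  "homogeneous n F \<longleftrightarrow> (\<forall>m. mcoeff F m \<noteq> 0 \<longrightarrow> size m = n)"

lemma mcoeff_mult:
  "mcoeff (F * G) m = (\<Sum>(a, b)\<in>{(a, b). a + b = m}. mcoeff F a * mcoeff G b)"
  by (simp add: times_mseries.rep_eq)

lemma mcoeff_sum: "mcoeff (sum F A) m = (\<Sum>i\<in>A. mcoeff (F i) m)"
  by (induction A rule: infinite_finite_induct)
     (auto simp: zero_mseries.rep_eq plus_mseries.rep_eq)

lemma e_fun_add_mset: "e_fun (add_mset k \<mu>) = elem_sym k * e_fun \<mu>"
  by (simp add: e_fun_def)

lemma symmetric_series_mult:
  assumes "symmetric_series F" "symmetric_series G"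
  shows "symmetric_series (F * G)"
  unfolding symmetric_series_def
proof (intro allI impI)
  fix \<pi> :: "nat \<Rightarrow> nat" and m assume \<pi>: "bij \<pi>"
  have inv: "image_mset (inv \<pi>) (image_mset \<pi> x) = x" "image_mset \<pi> (image_mset (inv \<pi>) x) = x" for x
    using \<pi> by (simp_all add: multiset.map_comp bij_is_inj bij_is_surj surj_iff[THEN iffD1])
  have *: "mcoeff F (image_mset \<pi> a) = mcoeff F a" "mcoeff G (image_mset \<pi> a) = mcoeff G a" for a
    using assms \<pi> by (auto simp: symmetric_series_def)
  show "mcoeff (F * G) (image_mset \<pi> m) = mcoeff (F * G) m"
    unfolding mcoeff_mult
    by (rule sum.reindex_bij_witness[of _ "map_prod (image_mset \<pi>) (image_mset \<pi>)"
          "map_prod (image_mset (inv \<pi>)) (image_mset (inv \<pi>))"])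
       (use *[of "image_mset (inv \<pi>) _"] in \<open>auto simp: inv simp flip: image_mset_union\<close>)
qed

lemma homogeneous_mult:
  assumes "homogeneous i F" "homogeneous j G"
  shows "homogeneous (i + j) (F * G)"
  unfolding homogeneous_def
proof (intro allI impI)
  fix m assume "mcoeff (F * G) m \<noteq> 0"
  then obtain p where "p \<in> {(a, b). a + b = m}" "(case p of (a, b) \<Rightarrow> mcoeff F a * mcoeff G b) \<noteq> 0"
    unfolding mcoeff_mult by (rule sum.not_neutral_contains_not_neutral)
  then show "size m = i + j"
    using assms by (auto simp: homogeneous_def)
qed

lemma symmetric_series_elem_sym: "symmetric_series (elem_sym k)"
proof -
  have *: "\<exists>A. finite A \<and> card A = k \<and> image_mset \<pi> m = mset_set A"
    if "bij \<pi>" "\<exists>A. finite A \<and> card A = k \<and> m = mset_set A" for \<pi> :: "nat \<Rightarrow> nat" and m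
  proof -
    from that(2) obtain A where "finite A" "card A = k" "m = mset_set A" by blast
    with \<open>bij \<pi>\<close> show ?thesis
      by (intro exI[of _ "\<pi> ` A"])
         (auto simp: image_mset_mset_set card_image bij_is_inj inj_on_subset[OF bij_is_inj])
  qed
  have "(\<exists>A. finite A \<and> card A = k \<and> image_mset \<pi> m = mset_set A) \<longleftrightarrow>
      (\<exists>A. finite A \<and> card A = k \<and> m = mset_set A)" if "bij \<pi>" for \<pi> :: "nat \<Rightarrow> nat" and m
    using *[OF that, of m] *[OF bij_imp_bij_inv[OF that], of "image_mset \<pi> m"] that
    by (auto simp: multiset.map_comp bij_is_inj)
  then show ?thesis
    by (simp add: symmetric_series_def elem_sym.rep_eq)
qed

lemma homogeneous_elem_sym: "homogeneous k (elem_sym k)"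
  by (auto simp: homogeneous_def elem_sym.rep_eq split: if_splits)

lemma symmetric_series_e_fun: "symmetric_series (e_fun \<mu>)"
proof (induction \<mu>)
  case empty
  then show ?case by (simp add: e_fun_def symmetric_series_def one_mseries.rep_eq)
qed (simp add: e_fun_add_mset symmetric_series_mult symmetric_series_elem_sym)

lemma homogeneous_e_fun: "homogeneous (sum_mset \<mu>) (e_fun \<mu>)"
proof (induction \<mu>)
  case empty
  then show ?case by (simp add: e_fun_def homogeneous_def one_mseries.rep_eq)
qed (simp add: e_fun_add_mset homogeneous_mult homogeneous_elem_sym)


text \<open>
  Multisets of variables are compared at the largest variable with different exponents. For this
  order, the smallest monomial of $e_\mu$ is the one whose exponents form the partition
  conjugate to $\mu$.
\<close>

definition conj_monomial :: "nat multiset \<Rightarrow> nat multiset" where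
  "conj_monomial \<mu> = (\<Sum>k\<in>#\<mu>. mset_set {..<k})"

lemma conj_monomial_add_mset:
  "conj_monomial (add_mset k \<mu>) = mset_set {..<k} + conj_monomial \<mu>"
  by (simp add: conj_monomial_def)

lemma count_conj_monomial: "count (conj_monomial \<mu>) i = size {#k \<in># \<mu>. i < k#}"
  by (induction \<mu>) (auto simp: conj_monomial_def)

text \<open>The multiplicity of the part \<open>Suc i\<close> is the difference of the exponents at
  i and \<open>Suc i\<close>. A part 0 would leave no trace in the monomial.\<close>

lemma inj_on_conj_monomial: "inj_on conj_monomial partitions"
proof (rule inj_onI, rule multiset_eqI)
  fix \<mu> \<nu> k
  assume *: "\<mu> \<in> partitions" "\<nu> \<in> partitions" "conj_monomial \<mu> = conj_monomial \<nu>"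
  show "count \<mu> k = count \<nu> k"
  proof (cases k)
    case 0
    with * show ?thesis by (auto simp: partitions_def not_in_iff)
  next
    case (Suc i)
    have "size {#k \<in># \<mu>. i < k#} = count \<mu> (Suc i) + size {#k \<in># \<mu>. Suc i < k#}" for \<mu>
      by (induction \<mu>) auto
    with Suc *(3) show ?thesis
      by (metis add_right_cancel count_conj_monomial)
  qed
qed

text \<open>Peeling off one copy of every variable that occurs removes the largest part of the
  partition sought.\<close>

lemma conj_monomial_surj:
  assumes "\<And>i. count m (Suc i) \<le> count m i"
  obtains \<mu> where "\<mu> \<in> partitions" "conj_monomial \<mu> = m"
  using assms
proof (induction "size m" arbitrary: m thesis rule: less_induct)
  case less
  show ?case
  proof (cases "m = {#}")
    case True
    then show ?thesis
      using less.prems(1)[of "{#}"] by (simp add: partitions_def conj_monomial_def)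
  next
    case False
    have anti: "count m j \<le> count m i" if "i \<le> j" for i j
      using lift_Suc_antimono_le[of "count m", OF less.prems(2) that] .
    \<comment> \<open>Exponents weakly decrease, so the variables that occur in m are exactly those
      below k.\<close>
    define k where "k = Suc (Max (set_mset m))"
    have fin: "finite (set_mset m)" "set_mset m \<noteq> {}" using False by auto
    have "Max (set_mset m) \<in> set_mset m" using fin by (rule Max_in)
    then have pos: "count m i > 0" if "i < k" for i
      using anti[of i "Max (set_mset m)"] that by (auto simp: k_def less_Suc_eq_le count_eq_zero_iff
        simp flip: count_greater_zero_iff)
    have zero: "count m i = 0" if "\<not> i < k" for i
    proof (rule ccontr)
      assume "count m i \<noteq> 0"
      then have "i \<in> set_mset m" by (simp add: not_in_iff[symmetric])
      then have "i \<le> Max (set_mset m)" using fin(1) by (rule Max_ge[rotated])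
      with that show False by (simp add: k_def)
    qed
    define m' where "m' = m - mset_set {..<k}"
    have sub: "mset_set {..<k} \<subseteq># m"
      using pos by (auto simp: subseteq_mset_def count_mset_set' Suc_le_eq)
    then have m: "m = mset_set {..<k} + m'" by (simp add: m'_def)
    have "k > 0" by (simp add: k_def)
    moreover from arg_cong[OF m, of size] have "size m = k + size m'" by simp
    ultimately have "size m' < size m" by linarith
    \<comment> \<open>Only i = k - 1 needs care: there the exponent at i drops by one while that at
      \<open>Suc i\<close> does not, but the latter is already 0.\<close>
    moreover have "count m' (Suc i) \<le> count m' i" for i
      using less.prems(2)[of i] zero[of "Suc i"] by (auto simp: m'_def count_mset_set')
    ultimately obtain \<mu> where \<mu>: "\<mu> \<in> partitions" "conj_monomial \<mu> = m'"
      using less.hyps[of m'] by blast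
    have "add_mset k \<mu> \<in> partitions" using \<mu>(1) \<open>k > 0\<close> by (simp add: partitions_def)
    moreover have "conj_monomial (add_mset k \<mu>) = m"
      unfolding conj_monomial_add_mset \<mu>(2) m[symmetric] ..
    ultimately show ?thesis by (rule less.prems(1))
  qed
qed

text \<open>Any other set of the same size has an element that is at least \<open>card A\<close>,
  hence larger than every index it misses below \<open>card A\<close>.\<close>

lemma mset_set_lessThan_less:
  assumes "finite A" "A \<noteq> {..<card A}"
  shows "mset_set {..<card A} < mset_set (A :: nat set)"
  unfolding less_multiset\<^sub>H\<^sub>O
proof (intro conjI allI impI)
  show "mset_set {..<card A} \<noteq> mset_set A"
    using assms by (metis finite_lessThan finite_set_mset_mset_set)
  fix y assume "count (mset_set A) y < count (mset_set {..<card A}) y"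
  have "\<not> A \<subseteq> {..<card A}"
    using assms by (metis card_lessThan card_subset_eq finite_lessThan)
  then obtain x where "x \<in> A" "x \<ge> card A" by force
  moreover from \<open>count _ _ < _\<close> have "y < card A" "y \<notin> A"
    by (auto simp: count_mset_set' split: if_splits)
  ultimately show "\<exists>x>y. count (mset_set {..<card A}) x < count (mset_set A) x"
    using assms by (intro exI[of _ x]) (auto simp: count_mset_set')
qed

text \<open>The order is compatible with products, so the least monomial of a product is the product
  of the least monomials and arises from one splitting only. The two claims go together because
  ruling out other splittings needs the second one for the shorter partition.\<close>

lemma e_fun_least_monomial:
  "mcoeff (e_fun \<mu>) (conj_monomial \<mu>) = 1"
  "m < conj_monomial \<mu> \<Longrightarrow> mcoeff (e_fun \<mu>) m = 0"
proof (induction \<mu> arbitrary: m)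
  case empty
  {
    case 1 then show ?case by (simp add: e_fun_def conj_monomial_def one_mseries.rep_eq)
  next
    case 2 then show ?case by (simp add: e_fun_def conj_monomial_def)
  }
next
  case (add k \<mu>)
  have elem: "mcoeff (elem_sym k) a = 0" if "a < mset_set {..<k}" for a
    using that mset_set_lessThan_less by (fastforce simp: elem_sym.rep_eq)
  have split: "mcoeff (elem_sym k) a * mcoeff (e_fun \<mu>) b = 0"
    if "a + b \<le> conj_monomial (add_mset k \<mu>)" "(a, b) \<noteq> (mset_set {..<k}, conj_monomial \<mu>)" for a b
  proof (rule ccontr)
    assume "mcoeff (elem_sym k) a * mcoeff (e_fun \<mu>) b \<noteq> 0"
    then have "mset_set {..<k} \<le> a" "conj_monomial \<mu> \<le> b"
      using elem add.IH(2) by (auto simp: not_less[symmetric])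
    with that(2) have "mset_set {..<k} + conj_monomial \<mu> < a + b"
      by (auto simp: order_le_less intro: add_strict_mono)
    with that(1) show False by (simp add: conj_monomial_add_mset)
  qed
  {
    case 1
    let ?M = "conj_monomial (add_mset k \<mu>)"
    have "mcoeff (e_fun (add_mset k \<mu>)) ?M =
        (\<Sum>(a, b)\<in>{(mset_set {..<k}, conj_monomial \<mu>)}. mcoeff (elem_sym k) a * mcoeff (e_fun \<mu>) b)"
      unfolding e_fun_add_mset mcoeff_mult
    proof (rule sum.mono_neutral_right)
      show "\<forall>p\<in>{(a, b). a + b = ?M} - {(mset_set {..<k}, conj_monomial \<mu>)}.
          (case p of (a, b) \<Rightarrow> mcoeff (elem_sym k) a * mcoeff (e_fun \<mu>) b) = 0"
      proof
        fix p assume p: "p \<in> {(a, b). a + b = ?M} - {(mset_set {..<k}, conj_monomial \<mu>)}"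
        obtain a b where "p = (a, b)" by fastforce
        with p split[of a b] show "(case p of (a, b) \<Rightarrow> mcoeff (elem_sym k) a * mcoeff (e_fun \<mu>) b) = 0"
          by simp
      qed
    qed (auto simp: finite_mset_splits conj_monomial_add_mset)
    also have "\<dots> = 1"
      using add.IH(1) by (auto simp: elem_sym.rep_eq)
    finally show ?case .
  next
    case 2
    then have "mcoeff (elem_sym k) a * mcoeff (e_fun \<mu>) b = 0" if "a + b = m" for a b
    proof -
      have "(a, b) \<noteq> (mset_set {..<k}, conj_monomial \<mu>)"
        using 2 that by (auto simp: conj_monomial_add_mset)
      with 2 that show ?thesis by (intro split) auto
    qed
    then show ?case
      unfolding e_fun_add_mset mcoeff_mult by (intro sum.neutral) auto
  }
qed

text \<open>At the least \<open>conj_monomial \<nu>\<close> among the terms with nonzero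
  coefficient, every other such term vanishes, and \<open>e_fun \<nu>\<close> has coefficient
  1.\<close>

lemma sum_e_fun_eq_0:
  assumes "finite P" "P \<subseteq> partitions" "(\<Sum>\<mu>\<in>P. mscale (c \<mu>) (e_fun \<mu>)) = 0" "\<mu> \<in> P"
  shows "c \<mu> = 0"
proof (rule ccontr)
  assume "c \<mu> \<noteq> 0"
  define Q where "Q = {\<mu> \<in> P. c \<mu> \<noteq> 0}"
  have "finite Q" "Q \<noteq> {}" using assms(1,4) \<open>c \<mu> \<noteq> 0\<close> by (auto simp: Q_def)
  then obtain \<nu> where \<nu>: "\<nu> \<in> Q" "\<And>\<mu>. \<mu> \<in> Q \<Longrightarrow> conj_monomial \<nu> \<le> conj_monomial \<mu>"
    using arg_min_if_finite[of Q conj_monomial] by (metis not_le)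
  have "c \<mu> * mcoeff (e_fun \<mu>) (conj_monomial \<nu>) = 0" if "\<mu> \<in> P - {\<nu>}" for \<mu>
  proof (cases "c \<mu> = 0")
    case False
    with that have "conj_monomial \<nu> \<le> conj_monomial \<mu>" by (intro \<nu>(2)) (auto simp: Q_def)
    moreover have "conj_monomial \<nu> \<noteq> conj_monomial \<mu>"
      using that \<nu>(1) assms(2) inj_on_conj_monomial by (auto simp: Q_def dest: inj_onD)
    ultimately show ?thesis by (simp add: e_fun_least_monomial)
  qed auto
  then have "(\<Sum>\<mu>\<in>P - {\<nu>}. c \<mu> * mcoeff (e_fun \<mu>) (conj_monomial \<nu>)) = 0"
    by (intro sum.neutral) blast
  then have "(\<Sum>\<mu>\<in>P. c \<mu> * mcoeff (e_fun \<mu>) (conj_monomial \<nu>)) = c \<nu>"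
    using \<nu>(1) assms(1) by (subst sum.remove[of _ \<nu>]) (auto simp: Q_def e_fun_least_monomial)
  moreover have "mcoeff (\<Sum>\<mu>\<in>P. mscale (c \<mu>) (e_fun \<mu>)) (conj_monomial \<nu>) =
      (\<Sum>\<mu>\<in>P. c \<mu> * mcoeff (e_fun \<mu>) (conj_monomial \<nu>))"
    by (simp add: mcoeff_sum mscale.rep_eq)
  ultimately show False
    using assms(3) \<nu>(1) by (simp add: Q_def zero_mseries.rep_eq)
qed

section \<open>Independence and extraction of coefficients\<close>

lemma inj_on_e_fun: "inj_on e_fun partitions"
proof (rule inj_onI, rule inj_onD[OF inj_on_conj_monomial])
  fix \<mu> \<nu> assume "e_fun \<mu> = e_fun \<nu>"
  then show "conj_monomial \<mu> = conj_monomial \<nu>"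
    by (metis e_fun_least_monomial linorder_less_linear zero_neq_one)
qed

lemma independent_e_basis: "mseries.independent e_basis"
proof -
  have "c f = 0" if "finite T" "T \<subseteq> e_basis" "(\<Sum>g\<in>T. mscale (c g) g) = 0" "f \<in> T" for T c f
  proof -
    obtain P where P: "P \<subseteq> partitions" "T = e_fun ` P" "inj_on e_fun P"
      using \<open>T \<subseteq> e_basis\<close> unfolding e_basis_def by (meson inj_on_e_fun inj_on_subset subset_imageE)
    with that obtain \<mu> where "\<mu> \<in> P" "f = e_fun \<mu>" by blast
    with P that show "c f = 0"
      using sum_e_fun_eq_0[of P "c \<circ> e_fun" \<mu>] by (simp add: sum.reindex finite_image_iff)
  qed
  then show ?thesis unfolding mseries.dependent_explicit by blast
qed

text \<open>\<open>e_coeff\<close> addresses basis vectors by partitions, so besides independence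
  the injectivity of \<open>e_fun\<close> enters.\<close>

lemma e_coeff_sum:
  assumes "finite P" "P \<subseteq> partitions" "\<mu> \<in> partitions"
  shows "e_coeff \<mu> (\<Sum>\<nu>\<in>P. mscale (c \<nu>) (e_fun \<nu>)) = (if \<mu> \<in> P then c \<mu> else 0)"
proof -
  have span: "e_fun \<nu> \<in> mseries.span e_basis" if "\<nu> \<in> partitions" for \<nu>
    using that by (auto simp: e_basis_def intro: mseries.span_base)
  have "e_coeff \<mu> (\<Sum>\<nu>\<in>P. mscale (c \<nu>) (e_fun \<nu>)) =
      (\<Sum>\<nu>\<in>P. c \<nu> * mseries.representation e_basis (e_fun \<nu>) (e_fun \<mu>))"
    unfolding e_coeff_def using assms(2)
    by (subst mseries.representation_sum)
       (auto simp: independent_e_basis mseries.representation_scale span mseries.span_scale subset_iff)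
  also have "\<dots> = (\<Sum>\<nu>\<in>P. if \<nu> = \<mu> then c \<nu> else 0)"
  proof (rule sum.cong)
    fix \<nu> assume "\<nu> \<in> P"
    then have "e_fun \<nu> = e_fun \<mu> \<longleftrightarrow> \<nu> = \<mu>"
      using assms inj_on_e_fun by (auto dest: inj_onD)
    moreover have "e_fun \<nu> \<in> e_basis" using \<open>\<nu> \<in> P\<close> assms by (auto simp: e_basis_def)
    ultimately show "c \<nu> * mseries.representation e_basis (e_fun \<nu>) (e_fun \<mu>) =
        (if \<nu> = \<mu> then c \<nu> else 0)"
      by (auto simp: mseries.representation_basis independent_e_basis)
  qed simp
  finally show ?thesis using assms(1) by simp
qed

section \<open>Expansion of symmetric homogeneous series\<close>

definition partitions_of :: "nat \<Rightarrow> nat multiset set" where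
  "partitions_of n = {\<mu> \<in> partitions. sum_mset \<mu> = n}"

lemma partitions_of_subset: "partitions_of n \<subseteq> partitions"
  by (auto simp: partitions_of_def)

lemma finite_multisets_of_size:
  assumes "finite A"
  shows "finite {m. set_mset m \<subseteq> A \<and> size m = n}"
proof (rule finite_surj)
  show "finite {xs. set xs \<subseteq> A \<and> length xs = n}" by (rule finite_lists_length_eq[OF assms])
  show "{m. set_mset m \<subseteq> A \<and> size m = n} \<subseteq> mset ` {xs. set xs \<subseteq> A \<and> length xs = n}"
    by (auto simp: image_iff) (metis ex_mset set_mset_mset size_mset)
qed

lemma finite_partitions_of: "finite (partitions_of n)"
proof (rule finite_subset)
  have "size \<mu> \<le> sum_mset \<mu>" if "0 \<notin># \<mu>" for \<mu> :: "nat multiset"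
    using that by (induction \<mu>) auto
  moreover have "k \<le> sum_mset \<mu>" if "k \<in># \<mu>" for k and \<mu> :: "nat multiset"
    using that by (auto dest!: multi_member_split)
  ultimately show "partitions_of n \<subseteq> (\<Union>l\<le>n. {\<mu>. set_mset \<mu> \<subseteq> {..n} \<and> size \<mu> = l})"
    by (auto simp: partitions_of_def partitions_def)
  show "finite (\<Union>l\<le>n. {\<mu>. set_mset \<mu> \<subseteq> {..n} \<and> size \<mu> = l})"
    by (intro finite_UN_I finite_multisets_of_size) auto
qed

lemma size_conj_monomial: "size (conj_monomial \<mu>) = sum_mset \<mu>"
  by (induction \<mu>) (auto simp: conj_monomial_def)

text \<open>The least monomial in the support of a nonzero F has weakly decreasing exponents, since
  otherwise a swap of two neighbouring variables would give a smaller one. So it is some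
  \<open>conj_monomial \<mu>\<close>.\<close>

lemma symmetric_series_eq_0:
  assumes "symmetric_series F" "homogeneous n F"
    and "\<And>\<mu>. \<mu> \<in> partitions_of n \<Longrightarrow> mcoeff F (conj_monomial \<mu>) = 0"
  shows "F = 0"
proof (rule mseries_eqI, rule ccontr)
  fix m0 assume "mcoeff F m0 \<noteq> mcoeff 0 m0"
  then have "m0 \<in> {m. mcoeff F m \<noteq> 0}" by (simp add: zero_mseries.rep_eq)
  then obtain m where m: "mcoeff F m \<noteq> 0" "\<And>m'. m' < m \<Longrightarrow> mcoeff F m' = 0"
    using wf_less_multiset[where ?'a = nat, THEN wfE_min, of m0 "{m. mcoeff F m \<noteq> 0}"] by auto
  have "count m (Suc i) \<le> count m i" for i
  proof (rule ccontr)
    assume *: "\<not> count m (Suc i) \<le> count m i"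
    let ?t = "transpose i (Suc i)"
    define m' where "m' = image_mset ?t m"
    have count: "count m' x = count m (?t x)" for x
    proof -
      have "m = image_mset ?t m'" by (simp add: m'_def multiset.map_comp)
      moreover have "count (image_mset ?t m') (?t x) = count m' x"
        by (induction m') (auto simp: transpose_eq_iff)
      ultimately show ?thesis by simp
    qed
    \<comment> \<open>\<open>m'\<close> exceeds m only at i, and m is ahead at the larger index
      \<open>Suc i\<close>.\<close>
    have "m' < m"
      unfolding less_multiset\<^sub>H\<^sub>O
    proof (intro conjI allI impI)
      show "m' \<noteq> m" using * count[of i] by auto
      fix y assume "count m y < count m' y"
      then have "y = i" using * by (auto simp: count transpose_def split: if_splits)
      then show "\<exists>x>y. count m' x < count m x"
        using * by (intro exI[of _ "Suc i"]) (auto simp: count)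
    qed
    then have "mcoeff F m' = 0" by (rule m(2))
    with assms(1) m(1) show False by (simp add: m'_def symmetric_series_def)
  qed
  then obtain \<mu> where "\<mu> \<in> partitions" "conj_monomial \<mu> = m"
    by (rule conj_monomial_surj)
  moreover from this have "sum_mset \<mu> = n"
    using assms(2) m(1) by (auto simp: homogeneous_def size_conj_monomial)
  ultimately show False using assms(3) m(1) by (auto simp: partitions_of_def)
qed

lemma symmetric_series_expansion:
  assumes "symmetric_series F" "homogeneous n F"
  shows "\<exists>c. F = (\<Sum>\<mu>\<in>partitions_of n. mscale (c \<mu>) (e_fun \<mu>))"
proof -
  \<comment> \<open>Q holds the partitions not yet cleared, and all others lie below Q in the order
    of \<open>conj_monomial\<close>. Subtracting a multiple of \<open>e_fun \<nu>\<close> with \<nu>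
    least in Q clears \<nu> and leaves the smaller monomials alone, since \<open>e_fun \<nu>\<close>
    vanishes there.\<close>
  have "\<exists>c. F = (\<Sum>\<mu>\<in>partitions_of n. mscale (c \<mu>) (e_fun \<mu>))"
    if "symmetric_series F" "homogeneous n F" "Q \<subseteq> partitions_of n"
      "\<And>\<mu> \<nu>. \<mu> \<in> Q \<Longrightarrow> \<nu> \<in> partitions_of n - Q \<Longrightarrow> conj_monomial \<nu> \<le> conj_monomial \<mu>"
      "\<And>\<mu>. \<mu> \<in> partitions_of n - Q \<Longrightarrow> mcoeff F (conj_monomial \<mu>) = 0" for Q
    using finite_subset[OF that(3) finite_partitions_of] that
  proof (induction "card Q" arbitrary: Q F)
    case 0
    then have "F = 0" by (intro symmetric_series_eq_0) auto
    then show ?case by (intro exI[of _ "\<lambda>_. 0"]) auto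
  next
    case (Suc l)
    from Suc.hyps(2) Suc.prems(1) have "Q \<noteq> {}" by auto
    with Suc.prems(1) obtain \<nu> where \<nu>: "\<nu> \<in> Q" "\<And>\<mu>. \<mu> \<in> Q \<Longrightarrow> conj_monomial \<nu> \<le> conj_monomial \<mu>"
      using arg_min_if_finite[of Q conj_monomial] by (metis not_le)
    define a where "a = mcoeff F (conj_monomial \<nu>)"
    define F' where "F' = F - mscale a (e_fun \<nu>)"
    have coeff: "mcoeff F' m = mcoeff F m - a * mcoeff (e_fun \<nu>) m" for m
      by (simp add: F'_def minus_mseries.rep_eq mscale.rep_eq)
    have \<nu>n: "\<nu> \<in> partitions_of n" using \<nu>(1) Suc.prems by blast
    have "\<exists>c. F' = (\<Sum>\<mu>\<in>partitions_of n. mscale (c \<mu>) (e_fun \<mu>))"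
    proof (rule Suc.hyps(1)[of "Q - {\<nu>}"])
      show "symmetric_series F'"
        using Suc.prems(2) symmetric_series_e_fun[of \<nu>] by (simp add: symmetric_series_def coeff)
      show "homogeneous n F'"
        using Suc.prems(3) homogeneous_e_fun[of \<nu>] \<nu>n
        by (auto simp: homogeneous_def coeff partitions_of_def) (metis diff_0_right mult_zero_right)
      show "mcoeff F' (conj_monomial \<mu>) = 0" if "\<mu> \<in> partitions_of n - (Q - {\<nu>})" for \<mu>
      proof (cases "\<mu> = \<nu>")
        case True
        then show ?thesis by (simp add: coeff a_def e_fun_least_monomial)
      next
        case False
        with that have "\<mu> \<in> partitions_of n - Q" by auto
        moreover from this have "conj_monomial \<mu> < conj_monomial \<nu>"
          using Suc.prems(5)[OF \<nu>(1)] False \<nu>n inj_on_conj_monomial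
          by (auto simp: order_le_less partitions_of_def dest: inj_onD)
        ultimately show ?thesis
          using Suc.prems(6) by (simp add: coeff e_fun_least_monomial)
      qed
    qed (use Suc \<nu> in auto)
    then obtain c where c: "F' = (\<Sum>\<mu>\<in>partitions_of n. mscale (c \<mu>) (e_fun \<mu>))" by blast
    have "mscale a (e_fun \<nu>) = (\<Sum>\<mu>\<in>partitions_of n. mscale (if \<mu> = \<nu> then a else 0) (e_fun \<mu>))"
      using \<nu>n by (subst sum.remove[OF finite_partitions_of \<nu>n]) (auto intro!: sum.neutral)
    with c have "F = (\<Sum>\<mu>\<in>partitions_of n. mscale (c \<mu> + (if \<mu> = \<nu> then a else 0)) (e_fun \<mu>))"
      by (simp add: mseries.scale_left_distrib sum.distrib F'_def algebra_simps)
    then show ?case by (intro exI)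
  qed
  from this[of "partitions_of n"] assms show ?thesis by blast
qed

lemma symmetric_series_eq_sum_e_coeff:
  assumes "symmetric_series F" "homogeneous n F"
  shows "F = (\<Sum>\<mu>\<in>partitions_of n. mscale (e_coeff \<mu> F) (e_fun \<mu>))"
proof -
  obtain c where c: "F = (\<Sum>\<mu>\<in>partitions_of n. mscale (c \<mu>) (e_fun \<mu>))"
    using symmetric_series_expansion[OF assms] by blast
  have "e_coeff \<mu> F = c \<mu>" if "\<mu> \<in> partitions_of n" for \<mu>
    using e_coeff_sum[OF finite_partitions_of partitions_of_subset, of \<mu> c n] that
    by (simp flip: c add: subsetD[OF partitions_of_subset])
  with c show ?thesis by simp
qed


subsection \<open>Colourings of trees\<close>

text \<open>The set S varies because colourings are counted while the tree is built up. The colours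
  below q are the indices of the variables that \<open>specialize\<close> keeps.\<close>

definition restricted_colorings :: "'a pair_pre_digraph \<Rightarrow> 'a set \<Rightarrow> nat \<Rightarrow> ('a \<Rightarrow> nat) set" where
  "restricted_colorings G S q =
    {\<kappa> \<in> S \<rightarrow>\<^sub>E {..<q}. \<forall>u\<in>S. \<forall>v\<in>S. (u, v) \<in> parcs G \<longrightarrow> \<kappa> u \<noteq> \<kappa> v}"

lemma finite_restricted_colorings: "finite S \<Longrightarrow> finite (restricted_colorings G S q)"
  by (rule finite_subset[of _ "S \<rightarrow>\<^sub>E {..<q}"]) (auto simp: restricted_colorings_def intro: finite_PiE)

text \<open>Every colour but that of u is free for v.\<close>

lemma (in pair_graph) card_restricted_colorings_insert:
  assumes "finite S" "v \<notin> S" "u \<in> S" "\<And>w. w \<in> S \<Longrightarrow> (v, w) \<in> parcs G \<longleftrightarrow> w = u"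
  shows "card (restricted_colorings G (insert v S) q) = card (restricted_colorings G S q) * (q - 1)"
proof -
  let ?C = "restricted_colorings G"
  have v: "(v, v) \<notin> parcs G" using no_loops' by blast
  have nbr: "(v, w) \<in> parcs G \<longleftrightarrow> w = u" "(w, v) \<in> parcs G \<longleftrightarrow> w = u" if "w \<in> S" for w
    using assms(4)[OF that] arcs_symmetric by blast+
  have "bij_betw (\<lambda>(\<kappa>, c). \<kappa>(v := c)) (Sigma (?C S q) (\<lambda>\<kappa>. {..<q} - {\<kappa> u})) (?C (insert v S) q)"
  proof (rule bij_betwI[where g = "\<lambda>\<kappa>. (restrict \<kappa> S, \<kappa> v)"])
    show "(\<lambda>(\<kappa>, c). \<kappa>(v := c)) \<in> Sigma (?C S q) (\<lambda>\<kappa>. {..<q} - {\<kappa> u}) \<rightarrow> ?C (insert v S) q"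
      using assms(2,3) v nbr by (auto simp: restricted_colorings_def PiE_def Pi_def extensional_def)
    show "(\<lambda>\<kappa>. (restrict \<kappa> S, \<kappa> v)) \<in> ?C (insert v S) q \<rightarrow> Sigma (?C S q) (\<lambda>\<kappa>. {..<q} - {\<kappa> u})"
      using assms(2,3) nbr by (auto simp: restricted_colorings_def)
    show "(\<lambda>\<kappa>. (restrict \<kappa> S, \<kappa> v)) (case p of (\<kappa>, c) \<Rightarrow> \<kappa>(v := c)) = p"
      if "p \<in> Sigma (?C S q) (\<lambda>\<kappa>. {..<q} - {\<kappa> u})" for p
      using that assms(2)
      by (auto simp: restricted_colorings_def fun_eq_iff PiE_def extensional_def restrict_def)
    show "(case (restrict \<kappa> S, \<kappa> v) of (\<kappa>, c) \<Rightarrow> \<kappa>(v := c)) = \<kappa>"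
      if "\<kappa> \<in> ?C (insert v S) q" for \<kappa>
      using that
      by (auto simp: restricted_colorings_def fun_eq_iff PiE_def extensional_def restrict_def)
  qed
  then have "card (?C (insert v S) q) = card (Sigma (?C S q) (\<lambda>\<kappa>. {..<q} - {\<kappa> u}))"
    by (simp add: bij_betw_same_card)
  also have "\<dots> = (\<Sum>\<kappa>\<in>?C S q. card ({..<q} - {\<kappa> u}))"
    using assms(1) by (intro card_SigmaI) (auto simp: finite_restricted_colorings)
  \<comment> \<open>The colour of u is below q, so exactly one colour is lost. For q = 0 the sum is
    empty, so the truncated \<open>q - 1\<close> is harmless.\<close>
  also have "\<dots> = (\<Sum>\<kappa>\<in>?C S q. q - 1)"
    using assms(3) by (intro sum.cong refl) (auto simp: restricted_colorings_def PiE_iff)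
  finally show ?thesis by simp
qed

text \<open>Given as a walk with its vertex list, so that it serves both to extend a path and to
  close a cycle, where v occurs twice.\<close>

lemma (in pair_graph) apath_snoc:
  assumes "apath x p u" "(u, v) \<in> parcs G"
  shows "awalk x (p @ [(u, v)]) v" "awalk_verts x (p @ [(u, v)]) = awalk_verts x p @ [v]"
proof -
  have p: "awalk x p u" using assms(1) unfolding apath_def by (rule conjunct1)
  have "awalk u [(u, v)] v"
    using arc_implies_awalk[of "(u, v)"] assms(2) by simp
  with p show walk: "awalk x (p @ [(u, v)]) v" by (rule awalk_appendI)
  have "last (awalk_verts x p) = u" using p by (rule awalkE')
  with awalk_verts_append[OF walk] show "awalk_verts x (p @ [(u, v)]) = awalk_verts x p @ [v]"
    by simp
qed

text \<open>
  The tree is built up one vertex at a time. A vertex with two neighbours in a connected set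
  would close a cycle, so every new vertex has exactly one neighbour among the previous ones.
\<close>

lemma (in pair_graph) acyclic_colorings_exhaustion:
  assumes conn: "\<And>u v. u \<in> pverts G \<Longrightarrow> v \<in> pverts G \<Longrightarrow> u \<rightarrow>\<^sup>*\<^bsub>with_proj G\<^esub> v"
    and acyc: "\<not> (\<exists>p. cycle p \<and> length p \<ge> 3)"
    and k: "Suc k \<le> card (pverts G)"
  shows "\<exists>S\<subseteq>pverts G. card S = Suc k \<and>
    (\<forall>u\<in>S. \<forall>v\<in>S. \<exists>p. apath u p v \<and> set (awalk_verts u p) \<subseteq> S) \<and>
    card (restricted_colorings G S q) = q * (q - 1) ^ k"
  using k
proof (induction k)
  case 0
  then obtain r where r: "r \<in> pverts G" by fastforce
  have "bij_betw (\<lambda>c. \<lambda>x\<in>{r}. c) {..<q} (restricted_colorings G {r} q)"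
    using no_loops'
    by (intro bij_betwI[where g = "\<lambda>\<kappa>. \<kappa> r"])
       (auto simp: restricted_colorings_def PiE_def extensional_def fun_eq_iff)
  then have "card (restricted_colorings G {r} q) = q"
    by (metis bij_betw_same_card card_lessThan)
  moreover have "apath r [] r" using r by (simp add: apath_Nil_iff)
  then have "\<forall>u\<in>{r}. \<forall>v\<in>{r}. \<exists>p. apath u p v \<and> set (awalk_verts u p) \<subseteq> {r}"
    by (auto intro!: exI[of _ "[]"])
  ultimately show ?case
    using r by (intro exI[of _ "{r}"]) auto
next
  case (Suc k)
  then obtain S where S: "S \<subseteq> pverts G" "card S = Suc k"
      "\<And>u v. u \<in> S \<Longrightarrow> v \<in> S \<Longrightarrow> \<exists>p. apath u p v \<and> set (awalk_verts u p) \<subseteq> S"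
      "card (restricted_colorings G S q) = q * (q - 1) ^ k"
    by auto
  have "finite S" using S(1) finite_verts by (auto intro: finite_subset)
  \<comment> \<open>Otherwise S would be closed under arcs and, by connectedness, contain every
    vertex.\<close>
  have "\<exists>u\<in>S. \<exists>v. v \<notin> S \<and> (u, v) \<in> parcs G"
  proof (rule ccontr)
    assume *: "\<not> ?thesis"
    have "S \<noteq> {}" "S \<noteq> pverts G" using S(2) Suc.prems by auto
    then obtain a b where ab: "a \<in> S" "b \<in> pverts G" "b \<notin> S" using S(1) by blast
    then have "a \<rightarrow>\<^sup>*\<^bsub>with_proj G\<^esub> b" using S(1) by (intro conn) auto
    then have "b \<in> S"
    proof (induction rule: reachable_induct)
      case (step x y)
      then have "(x, y) \<in> parcs G" by simp
      with step.IH * show ?case by blast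
    qed (rule ab(1))
    with ab show False by blast
  qed
  then obtain u v where uv: "u \<in> S" "v \<notin> S" "(u, v) \<in> parcs G" by blast
  then have vu: "(v, u) \<in> parcs G" by (blast intro: arcs_symmetric)
  have v: "v \<in> pverts G" using uv(3) in_arcsD2 by fastforce
  have unique: "w = u" if w: "w \<in> S" "(v, w) \<in> parcs G" for w
  proof (rule ccontr)
    assume "w \<noteq> u"
    \<comment> \<open>The path stays in S and so avoids v: closed up through v, it repeats no other
      vertex.\<close>
    obtain p where p: "apath u p w" "set (awalk_verts u p) \<subseteq> S"
      using S(3)[OF uv(1) w(1)] by blast
    \<comment> \<open>This separates the cycle from the closed walk v, u, v along a single
      edge.\<close>
    have "p \<noteq> []" using p(1) \<open>w \<noteq> u\<close> by (auto simp: apath_Nil_iff)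
    then have "length ((v, u) # p @ [(w, v)]) \<ge> 3" by (cases p) auto
    moreover have "cycle ((v, u) # p @ [(w, v)])"
    proof -
      have wv: "(w, v) \<in> parcs G" using w(2) by (blast intro: arcs_symmetric)
      with apath_snoc[OF p(1)] p uv vu show ?thesis
        by (auto simp: cycle_def apath_def awalk_Cons_iff intro!: exI[of _ v])
    qed
    ultimately show False using acyc by blast
  qed
  have path: "\<exists>p. apath x p y \<and> set (awalk_verts x p) \<subseteq> insert v S"
    if xy: "x \<in> insert v S" "y \<in> insert v S" for x y
  proof -
    consider "x = v" "y = v" | "x = v" "y \<in> S" | "x \<in> S" "y = v" | "x \<in> S" "y \<in> S"
      using xy by blast
    then show ?thesis
    proof cases
      case 1
      then show ?thesis using v by (intro exI[of _ "[]"]) (auto simp: apath_Nil_iff)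
    next
      case 2
      obtain p where "apath u p y" "set (awalk_verts u p) \<subseteq> S" using S(3)[OF uv(1) 2(2)] by blast
      with 2 vu uv(2) show ?thesis
        by (intro exI[of _ "(v, u) # p"]) (auto simp: apath_def awalk_Cons_iff)
    next
      case 3
      obtain p where p: "apath x p u" "set (awalk_verts x p) \<subseteq> S" using S(3)[OF 3(1) uv(1)] by blast
      with apath_snoc[OF p(1) uv(3)] p uv 3 show ?thesis
        by (intro exI[of _ "p @ [(u, v)]"]) (auto simp: apath_def)
    next
      case 4
      then show ?thesis using S(3) by blast
    qed
  qed
  have "card (restricted_colorings G (insert v S) q) = card (restricted_colorings G S q) * (q - 1)"
  proof (rule card_restricted_colorings_insert)
    show "(v, w) \<in> parcs G \<longleftrightarrow> w = u" if "w \<in> S" for w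
      using unique[OF that] vu by metis
  qed (fact \<open>finite S\<close> uv)+
  then have "card (restricted_colorings G (insert v S) q) = q * (q - 1) ^ Suc k"
    using S(4) by simp
  moreover have "card (insert v S) = Suc (Suc k)" using \<open>finite S\<close> uv(2) S(2) by simp
  ultimately show ?case using S(1) v path by (intro exI[of _ "insert v S"]) auto
qed

text \<open>Connectedness in the library includes having a vertex.\<close>

lemma tree_graphs_pos: "T \<in> tree_graphs n \<Longrightarrow> n > 0"
proof -
  assume T: "T \<in> tree_graphs n"
  then interpret pair_graph T by (simp add: tree_graphs_def connected_graphs_def)
  from T show "n > 0"
    using finite_verts by (auto simp: tree_graphs_def connected_graphs_def connected_def
      strongly_connected_def card_gt_0_iff)
qed

lemma card_tree_colorings:
  assumes "T \<in> tree_graphs n"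
  shows "card (restricted_colorings T (pverts T) q) = q * (q - 1) ^ (n - 1)"
proof -
  from assms interpret pair_graph T by (simp add: tree_graphs_def connected_graphs_def)
  have n: "card (pverts T) = n" "n > 0"
    using assms tree_graphs_pos by (auto simp: tree_graphs_def connected_graphs_def)
  have "\<exists>S\<subseteq>pverts T. card S = Suc (n - 1) \<and>
    (\<forall>u\<in>S. \<forall>v\<in>S. \<exists>p. apath u p v \<and> set (awalk_verts u p) \<subseteq> S) \<and>
    card (restricted_colorings T S q) = q * (q - 1) ^ (n - 1)"
  proof (rule acyclic_colorings_exhaustion)
    have "Digraph_Component.connected (with_proj T)"
      using assms by (simp add: tree_graphs_def connected_graphs_def)
    moreover have "symmetric (with_proj T)" by (rule sym_arcs)
    ultimately show "u \<rightarrow>\<^sup>*\<^bsub>with_proj T\<^esub> v" if "u \<in> pverts T" "v \<in> pverts T" for u v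
      using that reachable_mk_symmetric_eq by (auto simp: connected_def strongly_connected_def)
  qed (use assms n in \<open>auto simp: tree_graphs_def\<close>)
  then obtain S where S: "S \<subseteq> pverts T" "card S = n"
      "card (restricted_colorings T S q) = q * (q - 1) ^ (n - 1)"
    using n(2) by auto
  moreover from this have "S = pverts T"
    using n by (intro card_subset_eq) auto
  ultimately show ?thesis by simp
qed


subsection \<open>Specialization to the chromatic polynomial\<close>

text \<open>
  The coefficient of degree $d$ collects the monomials of degree $d$ of the series evaluated at
  $x_0 = \dots = x_{q-1} = 1$ and $x_i = 0$ for $i \ge q$.
\<close>

definition specialize :: "nat \<Rightarrow> rat mseries \<Rightarrow> rat fps" where
  "specialize q F = Abs_fps (\<lambda>d. \<Sum>m | set_mset m \<subseteq> {..<q} \<and> size m = d. mcoeff F m)"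

lemma specialize_nth:
  "fps_nth (specialize q F) d = (\<Sum>m | set_mset m \<subseteq> {..<q} \<and> size m = d. mcoeff F m)"
  by (simp add: specialize_def)

text \<open>Grading by degree keeps every sum finite and turns the product into a Cauchy product: a
  product of monomials lies in the kept variables iff both factors do, and degrees add.\<close>

lemma specialize_mult: "specialize q (F * G) = specialize q F * specialize q G"
proof (rule fps_ext)
  fix d
  let ?M = "\<lambda>d. {m :: nat multiset. set_mset m \<subseteq> {..<q} \<and> size m = d}"
  let ?S = "\<lambda>m :: nat multiset. {(a, b). a + b = m}"
  let ?f = "\<lambda>p. mcoeff F (fst p) * mcoeff G (snd p)"
  have fin: "finite (?M d)" for d by (rule finite_multisets_of_size) simp
  have "fps_nth (specialize q (F * G)) d = (\<Sum>m\<in>?M d. \<Sum>p\<in>?S m. ?f p)"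
    by (simp add: specialize_nth mcoeff_mult case_prod_beta)
  also have "\<dots> = (\<Sum>(m, p)\<in>Sigma (?M d) ?S. ?f p)"
    by (rule sum.Sigma) (auto simp: fin finite_mset_splits)
  also have "\<dots> = (\<Sum>(i, p)\<in>Sigma {0..d} (\<lambda>i. ?M i \<times> ?M (d - i)). ?f p)"
    by (rule sum.reindex_bij_witness[of _ "\<lambda>(i, a, b). (a + b, a, b)" "\<lambda>(m, a, b). (size a, a, b)"])
       auto
  also have "\<dots> = (\<Sum>i = 0..d. \<Sum>p\<in>?M i \<times> ?M (d - i). ?f p)"
    by (rule sum.Sigma[symmetric]) (auto simp: fin)
  also have "\<dots> = fps_nth (specialize q F * specialize q G) d"
    by (simp add: fps_mult_nth specialize_nth sum_product sum.cartesian_product case_prod_beta)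
  finally show "fps_nth (specialize q (F * G)) d = fps_nth (specialize q F * specialize q G) d" .
qed

lemma specialize_1: "specialize q 1 = 1"
proof (rule fps_ext)
  fix d
  have "fps_nth (specialize q 1) d =
      (\<Sum>m | set_mset m \<subseteq> {..<q} \<and> size m = d. if m = {#} then 1 else 0)"
    by (simp add: specialize_nth one_mseries.rep_eq)
  also have "\<dots> = fps_nth 1 d"
    by (subst sum.delta) (auto intro!: finite_multisets_of_size)
  finally show "fps_nth (specialize q 1) d = fps_nth 1 d" .
qed

text \<open>The monomials of \<open>elem_sym k\<close> in the kept variables correspond to the
  k-element subsets of \<open>{..<q}\<close>.\<close>

lemma specialize_elem_sym: "specialize q (elem_sym k) = fps_const (of_nat (q choose k)) * fps_X ^ k"
proof (rule fps_ext)
  fix d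
  let ?M = "{m :: nat multiset. set_mset m \<subseteq> {..<q} \<and> size m = d}"
  have fin: "finite ?M" by (rule finite_multisets_of_size) simp
  have fin': "finite A" if "A \<subseteq> {..<q}" for A
    using that by (rule finite_subset) simp
  have "fps_nth (specialize q (elem_sym k)) d =
      (\<Sum>m\<in>?M. if \<exists>A. finite A \<and> card A = k \<and> m = mset_set A then 1 else 0)"
    by (simp add: specialize_nth elem_sym.rep_eq)
  also have "\<dots> = of_nat (card {m \<in> ?M. \<exists>A. finite A \<and> card A = k \<and> m = mset_set A})"
    using fin by (simp add: sum.If_cases Int_def)
  also have "{m \<in> ?M. \<exists>A. finite A \<and> card A = k \<and> m = mset_set A} =
      (if d = k then mset_set ` {A. A \<subseteq> {..<q} \<and> card A = k} else {})"
  proof (intro equalityI subsetI)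
    fix m assume "m \<in> {m \<in> ?M. \<exists>A. finite A \<and> card A = k \<and> m = mset_set A}"
    then obtain A where "finite A" "card A = k" "m = mset_set A" "m \<in> ?M" by blast
    then show "m \<in> (if d = k then mset_set ` {A. A \<subseteq> {..<q} \<and> card A = k} else {})"
      by simp
  next
    fix m assume m: "m \<in> (if d = k then mset_set ` {A. A \<subseteq> {..<q} \<and> card A = k} else {})"
    then have "d = k" by (simp split: if_splits)
    with m obtain A where "A \<subseteq> {..<q}" "card A = k" "m = mset_set A" by auto
    with fin'[of A] \<open>d = k\<close> show "m \<in> {m \<in> ?M. \<exists>A. finite A \<and> card A = k \<and> m = mset_set A}"
      by simp blast
  qed
  also have "card \<dots> = (if d = k then q choose k else 0)"
  proof -
    have "inj_on mset_set {A. A \<subseteq> {..<q} \<and> card A = k}"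
      by (rule inj_on_subset[OF inj_on_inverseI[of "Collect finite" set_mset]])
         (simp_all add: fin' subset_iff)
    then show ?thesis by (simp add: card_image n_subsets)
  qed
  finally show "fps_nth (specialize q (elem_sym k)) d =
      fps_nth (fps_const (of_nat (q choose k)) * fps_X ^ k) d"
    by (simp add: fps_X_power_iff)
qed

lemma specialize_e_fun:
  "specialize q (e_fun \<mu>) =
    fps_const (\<Prod>k\<in>#\<mu>. of_nat (q choose k)) * fps_X ^ sum_mset \<mu>"
proof (induction \<mu>)
  case empty
  then show ?case by (simp add: e_fun_def specialize_1)
next
  case (add k \<mu>)
  then show ?case
    by (simp add: e_fun_add_mset specialize_mult specialize_elem_sym power_add mult_ac
      flip: fps_const_mult)
qed

lemma specialize_sum_mscale:
  "fps_nth (specialize q (\<Sum>i\<in>I. mscale (c i) (F i))) d =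
    (\<Sum>i\<in>I. c i * fps_nth (specialize q (F i)) d)"
  by (simp add: specialize_nth mcoeff_sum mscale.rep_eq sum_distrib_left) (rule sum.swap)

text \<open>Each proper colouring with colours below q is counted at its own monomial, which has
  degree \<open>card (pverts G)\<close>.\<close>

lemma specialize_chrom_sym:
  assumes "pair_graph G"
  shows "fps_nth (specialize q (chrom_sym G)) (card (pverts G)) =
    of_nat (card (restricted_colorings G (pverts G) q))"
proof -
  let ?V = "pverts G"
  let ?M = "{m :: nat multiset. set_mset m \<subseteq> {..<q} \<and> size m = card ?V}"
  let ?K = "\<lambda>m. {\<kappa> \<in> proper_colorings G. image_mset \<kappa> (mset_set ?V) = m}"
  interpret pair_graph G by fact
  have "fps_nth (specialize q (chrom_sym G)) (card ?V) = of_nat (\<Sum>m\<in>?M. card (?K m))"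
    by (simp add: specialize_nth chrom_sym.rep_eq)
  also have "(\<Sum>m\<in>?M. card (?K m)) = card (\<Union>m\<in>?M. ?K m)"
    by (intro card_UN_disjoint[symmetric] finite_multisets_of_size)
       (auto intro: finite_colorings_with_monomial)
  \<comment> \<open>The two notions of properness agree because all arcs run between vertices of
    G.\<close>
  also have "(\<Union>m\<in>?M. ?K m) = restricted_colorings G ?V q"
    using in_arcsD1 in_arcsD2
    by (fastforce simp: restricted_colorings_def proper_colorings_def PiE_iff image_subset_iff)
  finally show ?thesis .
qed

section \<open>Symmetry and homogeneity of the chromatic symmetric function\<close>

lemma symmetric_series_chrom_sym:
  assumes "pair_graph G"
  shows "symmetric_series (chrom_sym G)"
  unfolding symmetric_series_def
proof (intro allI impI)
  interpret pair_graph G by fact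
  fix \<pi> :: "nat \<Rightarrow> nat" and m assume \<pi>: "bij \<pi>"
  let ?V = "pverts G"
  let ?K = "\<lambda>m. {\<kappa> \<in> proper_colorings G. image_mset \<kappa> (mset_set ?V) = m}"
  have inv: "inv \<pi> (\<pi> x) = x" "\<pi> (inv \<pi> x) = x" for x
    using \<pi> by (simp_all add: bij_is_inj bij_is_surj surj_f_inv_f)
  have inj: "\<pi> x = \<pi> y \<longleftrightarrow> x = y" "inv \<pi> x = inv \<pi> y \<longleftrightarrow> x = y" for x y
    by (metis inv)+
  have comp: "image_mset (restrict (\<sigma> \<circ> \<kappa>) ?V) (mset_set ?V) = image_mset \<sigma> (image_mset \<kappa> (mset_set ?V))"
    for \<sigma> :: "nat \<Rightarrow> nat" and \<kappa> :: "'a \<Rightarrow> nat"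
    by (auto simp: multiset.map_comp intro: image_mset_cong)
  \<comment> \<open>An injective renaming of the colours preserves properness, and
    \<open>restrict\<close> restores extensionality.\<close>
  have image: "restrict (\<sigma> \<circ> \<kappa>) ?V \<in> ?K (image_mset \<sigma> m)" if "\<kappa> \<in> ?K m" "inj \<sigma>" for \<sigma> \<kappa> m
    using that in_arcsD1 in_arcsD2 unfolding mem_Collect_eq comp
    by (fastforce simp: proper_colorings_def inj_eq)
  have "bij_betw (\<lambda>\<kappa>. restrict (\<pi> \<circ> \<kappa>) ?V) (?K m) (?K (image_mset \<pi> m))"
  proof (rule bij_betwI[where g = "\<lambda>\<kappa>. restrict (inv \<pi> \<circ> \<kappa>) ?V"])
    show "(\<lambda>\<kappa>. restrict (inv \<pi> \<circ> \<kappa>) ?V) \<in> ?K (image_mset \<pi> m) \<rightarrow> ?K m"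
    proof
      fix \<kappa> assume "\<kappa> \<in> ?K (image_mset \<pi> m)"
      from image[OF this, of "inv \<pi>"] show "restrict (inv \<pi> \<circ> \<kappa>) ?V \<in> ?K m"
        by (simp add: multiset.map_comp comp_def inv inj inj_on_def)
    qed
  qed (use image[of _ _ \<pi>] in \<open>auto simp: proper_colorings_def extensional_def restrict_def inv inj
         inj_on_def fun_eq_iff\<close>)
  then show "mcoeff (chrom_sym G) (image_mset \<pi> m) = mcoeff (chrom_sym G) m"
    by (simp add: chrom_sym.rep_eq bij_betw_same_card)
qed

lemma homogeneous_chrom_sym: "homogeneous (card (pverts G)) (chrom_sym G)"
  unfolding homogeneous_def
proof (intro allI impI)
  fix m assume "mcoeff (chrom_sym G) m \<noteq> 0"
  then have "card {\<kappa> \<in> proper_colorings G. image_mset \<kappa> (mset_set (pverts G)) = m} \<noteq> 0"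
    by (simp add: chrom_sym.rep_eq)
  then have "{\<kappa> \<in> proper_colorings G. image_mset \<kappa> (mset_set (pverts G)) = m} \<noteq> {}"
    by (metis card.empty)
  then show "size m = card (pverts G)" by auto
qed


section \<open>The polynomial identity for the coefficients of a tree\<close>

definition binomial_poly :: "nat \<Rightarrow> rat poly" where
  "binomial_poly k = smult (1 / fact k) (\<Prod>i<k. [:- of_nat i, 1:])"

lemma poly_binomial_poly: "poly (binomial_poly k) x = x gchoose k"
  by (simp add: binomial_poly_def poly_prod gbinomial_prod_rev atLeast0LessThan)

lemma coeff_binomial_poly_0: "k > 0 \<Longrightarrow> coeff (binomial_poly k) 0 = 0"
  using poly_binomial_poly[of k 0] by (cases k) (auto simp: poly_0_coeff_0)

text \<open>A partition of n other than (n) has at least two parts, and each contributes a factor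
  with root 0.\<close>

lemma coeff_prod_binomial_poly_1:
  assumes "\<mu> \<in> partitions_of n" "\<mu> \<noteq> {#n#}" "n > 0"
  shows "coeff (\<Prod>k\<in>#\<mu>. binomial_poly k) 1 = 0"
proof -
  have "\<mu> \<noteq> {#}" using assms(1,3) by (auto simp: partitions_of_def)
  then obtain k \<nu>' where 1: "\<mu> = add_mset k \<nu>'" by (meson multiset_cases)
  with assms(1,2) have "\<nu>' \<noteq> {#}" by (auto simp: partitions_of_def)
  then obtain l \<nu> where "\<nu>' = add_mset l \<nu>" by (meson multiset_cases)
  with 1 have \<mu>: "\<mu> = add_mset k (add_mset l \<nu>)" by simp
  with assms(1) have "k > 0" "l > 0" by (auto simp: partitions_of_def partitions_def)
  then show ?thesis
    by (simp add: \<mu> coeff_mult coeff_binomial_poly_0)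
qed

lemma tree_e_coeff_poly:
  assumes "T \<in> tree_graphs n"
  shows "(\<Sum>\<mu>\<in>partitions_of n. smult (e_coeff \<mu> (chrom_sym T)) (\<Prod>k\<in>#\<mu>. binomial_poly k)) =
    [:0, 1:] * [:-1, 1:] ^ (n - 1)" (is "?p = ?r")
proof -
  from assms interpret pair_graph T by (simp add: tree_graphs_def connected_graphs_def)
  have n: "card (pverts T) = n" "n > 0"
    using assms tree_graphs_pos by (auto simp: tree_graphs_def connected_graphs_def)
  let ?c = "\<lambda>\<mu>. e_coeff \<mu> (chrom_sym T)"
  have "poly (\<Prod>k\<in>#\<mu>. binomial_poly k) (of_nat q) = (\<Prod>k\<in>#\<mu>. of_nat (q choose k))" for \<mu> q
    by (induction \<mu>) (auto simp: poly_binomial_poly binomial_gbinomial)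
  then have "poly ?p (of_nat q) =
      (\<Sum>\<mu>\<in>partitions_of n. ?c \<mu> * (\<Prod>k\<in>#\<mu>. of_nat (q choose k)))" for q
    by (simp add: poly_sum)
  also have "\<dots> q = (\<Sum>\<mu>\<in>partitions_of n. ?c \<mu> * fps_nth (specialize q (e_fun \<mu>)) n)" for q
    by (intro sum.cong) (auto simp: specialize_e_fun partitions_of_def)
  also have "\<dots> q = fps_nth (specialize q (chrom_sym T)) n" for q
    by (subst (2) symmetric_series_eq_sum_e_coeff[of _ n])
       (use n symmetric_series_chrom_sym[OF pair_graph_axioms] homogeneous_chrom_sym[of T]
        in \<open>simp_all add: specialize_sum_mscale\<close>)
  also have "\<dots> q = of_nat (q * (q - 1) ^ (n - 1))" for q
    using specialize_chrom_sym[OF pair_graph_axioms, of q] n card_tree_colorings[OF assms, of q]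
    by simp
  \<comment> \<open>At q = 0 the truncated \<open>q - 1\<close> differs from the rational one, but
    the factor q makes both sides 0.\<close>
  also have "\<dots> q = poly ?r (of_nat q)" for q
    by (cases q) (auto simp: algebra_simps)
  finally have "range of_nat \<subseteq> {x. poly (?p - ?r) x = 0}" by auto
  moreover have "infinite (range of_nat :: rat set)"
    by (simp add: range_inj_infinite inj_of_nat)
  ultimately have "infinite {x. poly (?p - ?r) x = 0}"
    using finite_subset by blast
  then have "?p - ?r = 0" using poly_roots_finite by blast
  then show ?thesis by simp
qed

text \<open>The right side depends on n alone and is nonzero, so any two trees share the coefficient
  at (n), and it does not vanish.\<close>

lemma tree_e_coeff_singleton:
  assumes "T \<in> tree_graphs n"
  shows "e_coeff {#n#} (chrom_sym T) * coeff (binomial_poly n) 1 = (-1) ^ (n - 1)"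
proof -
  have n: "n > 0" using assms by (rule tree_graphs_pos)
  then have "{#n#} \<in> partitions_of n" by (simp add: partitions_of_def partitions_def)
  moreover have "coeff (\<Prod>k\<in>#\<mu>. binomial_poly k) 1 = 0" if "\<mu> \<in> partitions_of n - {{#n#}}" for \<mu>
    using that n by (intro coeff_prod_binomial_poly_1[of _ n]) auto
  ultimately have "e_coeff {#n#} (chrom_sym T) * coeff (binomial_poly n) 1 =
     (\<Sum>\<mu>\<in>partitions_of n. e_coeff \<mu> (chrom_sym T) * coeff (\<Prod>k\<in>#\<mu>. binomial_poly k) 1)"
    by (simp add: sum.remove[OF finite_partitions_of])
  also have "\<dots> = coeff ([:0, 1:] * [:-1, 1:] ^ (n - 1)) 1"
    unfolding tree_e_coeff_poly[OF assms, symmetric] by (simp add: coeff_sum)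
  \<comment> \<open>The linear coefficient of x p(x) is p(0).\<close>
  also have "\<dots> = poly ([:-1, 1:] ^ (n - 1)) 0"
    by (simp add: poly_0_coeff_0)
  finally show ?thesis by (simp add: poly_power)
qed

lemma tree_sum_e_coeff:
  assumes "T \<in> tree_graphs n"
  shows "(\<Sum>\<mu>\<in>partitions_of n. e_coeff \<mu> (chrom_sym T)) = 2 ^ (n - 1)"
proof -
  \<comment> \<open>Negating the upper index gives binom(-1,k) = (-1)^k binom(k,k).\<close>
  have binom: "poly (binomial_poly k) (-1) = (-1) ^ k" for k
    using gbinomial_minus[of "1 :: rat" k] by (simp add: poly_binomial_poly binomial_gbinomial[symmetric])
  have "poly (\<Prod>k\<in>#\<mu>. binomial_poly k) (-1) = (-1) ^ sum_mset \<mu>" for \<mu>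
    by (induction \<mu>) (auto simp: binom power_add)
  then have "(\<Sum>\<mu>\<in>partitions_of n. e_coeff \<mu> (chrom_sym T) * (-1) ^ n) =
      poly (\<Sum>\<mu>\<in>partitions_of n. smult (e_coeff \<mu> (chrom_sym T)) (\<Prod>k\<in>#\<mu>. binomial_poly k)) (-1)"
    by (simp add: poly_sum partitions_of_def)
  also have "\<dots> = - ((-2) ^ (n - 1))"
    by (simp add: tree_e_coeff_poly[OF assms])
  also have "\<dots> = 2 ^ (n - 1) * (-1) ^ n"
    using tree_graphs_pos[OF assms] by (cases n) (simp_all add: power_minus[of 2])
  finally show ?thesis by (simp flip: sum_distrib_right)
qed

section \<open>Comparison of two trees\<close>

lemma tree_geq_e_imp_eq:
  assumes "T1 \<in> tree_graphs n" "T2 \<in> tree_graphs n" "T1 \<ge>\<^sub>e T2"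
  shows "chrom_sym T1 = chrom_sym T2"
proof -
  let ?c1 = "\<lambda>\<mu>. e_coeff \<mu> (chrom_sym T1)" and ?c2 = "\<lambda>\<mu>. e_coeff \<mu> (chrom_sym T2)"
  have card: "card (pverts T1) = n" "card (pverts T2) = n"
    and graph: "pair_graph T1" "pair_graph T2"
    using assms(1,2) by (auto simp: tree_graphs_def connected_graphs_def)
  have exp1: "chrom_sym T1 = (\<Sum>\<mu>\<in>partitions_of n. mscale (?c1 \<mu>) (e_fun \<mu>))"
    using symmetric_series_chrom_sym[OF graph(1)] homogeneous_chrom_sym[of T1] card(1)
    by (intro symmetric_series_eq_sum_e_coeff) auto
  have exp2: "chrom_sym T2 = (\<Sum>\<mu>\<in>partitions_of n. mscale (?c2 \<mu>) (e_fun \<mu>))"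
    using symmetric_series_chrom_sym[OF graph(2)] homogeneous_chrom_sym[of T2] card(2)
    by (intro symmetric_series_eq_sum_e_coeff) auto
  \<comment> \<open>The second fact guards the division: the denominator in \<open>X_e\<close> is
    nonzero, so the quotient is really 1.\<close>
  have "?c1 {#n#} * coeff (binomial_poly n) 1 = ?c2 {#n#} * coeff (binomial_poly n) 1"
    "?c2 {#n#} * coeff (binomial_poly n) 1 \<noteq> 0"
    using assms(1,2) by (simp_all only: tree_e_coeff_singleton) simp
  then have "?c1 {#n#} / ?c2 {#n#} = 1" by simp
  then have "X_e T1 T2 = chrom_sym T1 - chrom_sym T2"
    by (simp add: X_e_def card)
  also have "\<dots> = (\<Sum>\<mu>\<in>partitions_of n. mscale (?c1 \<mu> - ?c2 \<mu>) (e_fun \<mu>))"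
    by (subst exp1, subst exp2) (simp add: mseries.scale_left_diff_distrib sum_subtractf)
  finally have "e_coeff \<mu> (X_e T1 T2) = ?c1 \<mu> - ?c2 \<mu>" if "\<mu> \<in> partitions_of n" for \<mu>
    using that e_coeff_sum[OF finite_partitions_of partitions_of_subset, of \<mu> "\<lambda>\<mu>. ?c1 \<mu> - ?c2 \<mu>" n]
    by (simp add: subsetD[OF partitions_of_subset])
  then have nonneg: "?c1 \<mu> - ?c2 \<mu> \<ge> 0" if "\<mu> \<in> partitions_of n" for \<mu>
    using that assms(3) partitions_of_subset by (fastforce simp: geq_e_def e_positive_def)
  have "(\<Sum>\<mu>\<in>partitions_of n. ?c1 \<mu> - ?c2 \<mu>) = 0"
    using assms(1,2) by (simp add: sum_subtractf tree_sum_e_coeff)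
  then have "?c1 \<mu> = ?c2 \<mu>" if "\<mu> \<in> partitions_of n" for \<mu>
    using that nonneg sum_nonneg_eq_0_iff[OF finite_partitions_of, of n "\<lambda>\<mu>. ?c1 \<mu> - ?c2 \<mu>"] by simp
  then have "(\<Sum>\<mu>\<in>partitions_of n. mscale (?c1 \<mu>) (e_fun \<mu>)) =
      (\<Sum>\<mu>\<in>partitions_of n. mscale (?c2 \<mu>) (e_fun \<mu>))"
    by (intro sum.cong) simp_all
  then show ?thesis by (rule trans[OF exp1 trans[OF _ exp2[symmetric]]])
qed

theorem corollary3p8:
  fixes n :: nat
  shows "antichain_in_csf_poset n (tree_classes n :: 'a pair_pre_digraph set set) \<and>
    (\<forall>(T1 :: 'a pair_pre_digraph) (T2 :: 'a pair_pre_digraph).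
       T1 \<in> tree_graphs n \<longrightarrow> T2 \<in> tree_graphs n \<longrightarrow> chrom_sym T1 \<noteq> chrom_sym T2 \<longrightarrow>
       \<not> T1 \<ge>\<^sub>e T2 \<and> \<not> T2 \<ge>\<^sub>e T1)"
proof (intro conjI allI impI)
  have conn: "T \<in> connected_graphs n" if "T \<in> tree_graphs n" for T :: "'a pair_pre_digraph"
    using that by (simp add: tree_graphs_def)
  \<comment> \<open>The order on classes can be tested on T1 and T2 themselves, and different
    classes mean different chromatic symmetric functions.\<close>
  have "\<not> class_geq_e (csf_rel n `` {T1}) (csf_rel n `` {T2})"
    if "T1 \<in> tree_graphs n" "T2 \<in> tree_graphs n" "csf_rel n `` {T1} \<noteq> csf_rel n `` {T2}"
    for T1 T2 :: "'a pair_pre_digraph"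
  proof -
    have "chrom_sym T1 \<noteq> chrom_sym T2"
      using that conn by (auto simp: csf_rel_def)
    then show ?thesis
      using that(1,2) conn by (auto simp: class_geq_e_iff dest: tree_geq_e_imp_eq)
  qed
  then show "antichain_in_csf_poset n (tree_classes n :: 'a pair_pre_digraph set set)"
    using conn by (auto simp: antichain_in_csf_poset_def tree_classes_def csf_classes_def
      pairwise_def intro!: quotientI)
qed (auto dest: tree_geq_e_imp_eq)

end
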